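(* Let $\mathcal{P}=(\mathcal{E},D,c,f_c)$ be a Minimum Spanning Tree Problem on a connected undirected graph and $E=\{e_1,e_2,\dots,e_k\}\subseteq\mathcal{E}$. Then $\sum_{i=1}^k l'_{\mathcal{P}}(e_i)=l'_{\mathcal{P}}(E)$.
   Context: Let $\Gamma$ be a connected undirected graph with weight function $c:E(\Gamma)\to\mathbb{R}$. The Minimum Spanning Tree Problem (MSTP) is the combinatorial sum problem $\mathcal{P}=(\mathcal{E},D,c,f_c)$ with $\mathcal{E}=E(\Gamma)$, $D$ the set of spanning trees of $\Gamma$ and $f_c(T)=\sum_{e\in E(T)}c(e)$; $c^\ast$ is the minimum value of $f_c$ over $D$. For $E=\{e_1,\dots,e_k\}$ and $\vec\alpha\in\mathbb{R}^k$, $\mathcal{P}_{c_{-\vec\alpha,E}}$ is the problem with the cost of $e_i$ changed to $c(e_i)-\alpha_i$ and all other costs unchanged; $\mathcal{P}_{c_{-\alpha,e}}$ is the analogue for a single edge. Single lower tolerance: $l'_{\mathcal{P}}(e)=\max\{\alpha\ge0:$ the optimal value of $\mathcal{P}_{c_{-\alpha,e}}$ equals $c^\ast\}$. Set lower tolerance: $l'_{\mathcal{P}}(E)=\max\{\alpha\in\mathbb{R}:$ there exists $\vec\alpha=(\alpha_1,\dots,\alpha_k)$ with all $\alpha_i\ge0$, $\alpha=\sum_i\alpha_i$, such that the optimal value of $\mathcal{P}_{c_{-\vec\alpha,E}}$ equals $c^\ast\}$. Tolerances take the value $\infty$ when the set is unbounded. *)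

theory Defs
  imports "HOL-Library.Extended_Real"
begin

text \<open>
  The undirected graphs below may have parallel edges and loops. A simple graph is the special case
  in which every edge has two ends and distinct edges have distinct end sets, e.g. \<open>ends = id\<close> with
  two-element sets as edges.
\<close>

record ('v, 'e) ugraph =
  verts :: "'v set"
  edges :: "'e set"
  ends :: "'e \<Rightarrow> 'v set"

definition finite_ugraph :: "('v, 'e) ugraph \<Rightarrow> bool" where
  "finite_ugraph G \<longleftrightarrow> finite (verts G) \<and> finite (edges G) \<and>
     (\<forall>e\<in>edges G. ends G e \<subseteq> verts G \<and> card (ends G e) \<in> {1, 2})"

definition adjacency :: "('v, 'e) ugraph \<Rightarrow> ('v \<times> 'v) set" where
  "adjacency G = {(u, v). \<exists>e\<in>edges G. ends G e = {u, v}}"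

definition connected_ugraph :: "('v, 'e) ugraph \<Rightarrow> bool" where
  "connected_ugraph G \<longleftrightarrow> verts G \<noteq> {} \<and> (\<forall>u\<in>verts G. \<forall>v\<in>verts G. (u, v) \<in> (adjacency G)\<^sup>*)"

text \<open>
  A cycle is given by its vertices \<open>v\<^sub>0, \<dots>, v\<^sub>n\<^sub>-\<^sub>1\<close> and edges \<open>e\<^sub>0, \<dots>, e\<^sub>n\<^sub>-\<^sub>1\<close>, where \<open>e\<^sub>i\<close> joins \<open>v\<^sub>i\<close>
  and \<open>v\<^sub>i\<^sub>+\<^sub>1\<close> (indices modulo \<open>n\<close>). A loop is a cycle with \<open>n = 1\<close>, two parallel edges form one with
  \<open>n = 2\<close>. As the edges are distinct, all cycles of a simple graph have \<open>n \<ge> 3\<close>.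
\<close>

definition is_cycle :: "('v, 'e) ugraph \<Rightarrow> 'v list \<Rightarrow> 'e list \<Rightarrow> bool" where
  "is_cycle G vs es \<longleftrightarrow> vs \<noteq> [] \<and> length es = length vs \<and> distinct vs \<and> distinct es \<and>
     set vs \<subseteq> verts G \<and> set es \<subseteq> edges G \<and>
     (\<forall>i<length vs. ends G (es ! i) = {vs ! i, vs ! (Suc i mod length vs)})"

definition tree_ugraph :: "('v, 'e) ugraph \<Rightarrow> bool" where
  "tree_ugraph G \<longleftrightarrow> connected_ugraph G \<and> (\<nexists>vs es. is_cycle G vs es)"

text \<open>A spanning tree has all vertices of the graph, so it is represented by its edge set.\<close>

definition spanning_trees :: "('v, 'e) ugraph \<Rightarrow> 'e set set" where
  "spanning_trees G = {T. T \<subseteq> edges G \<and> tree_ugraph (G\<lparr>edges := T\<rparr>)}"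

record 'e sum_problem =
  ground :: "'e set"
  feasible :: "'e set set"
  cost :: "'e \<Rightarrow> real"

definition objective :: "'e sum_problem \<Rightarrow> 'e set \<Rightarrow> real" where
  "objective P S = (\<Sum>e\<in>S. cost P e)"

text \<open>Meaningful if there are only finitely many, and at least one, feasible solutions.\<close>

definition optimal_value :: "'e sum_problem \<Rightarrow> real" where
  "optimal_value P = Min (objective P ` feasible P)"

text \<open>
  Being a maximum, not a supremum, this is unspecified for a bounded set without greatest element.
\<close>

definition max_or_infinity :: "real set \<Rightarrow> ereal" where
  "max_or_infinity A = (if bdd_above A then ereal (GREATEST x. x \<in> A) else \<infinity>)"

definition decrease_edge :: "'e sum_problem \<Rightarrow> 'e \<Rightarrow> real \<Rightarrow> 'e sum_problem" where
  "decrease_edge P e \<alpha> = P\<lparr>cost := (cost P)(e := cost P e - \<alpha>)\<rparr>"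

definition decrease_set :: "'e sum_problem \<Rightarrow> 'e set \<Rightarrow> ('e \<Rightarrow> real) \<Rightarrow> 'e sum_problem" where
  "decrease_set P E \<alpha> = P\<lparr>cost := (\<lambda>e. if e \<in> E then cost P e - \<alpha> e else cost P e)\<rparr>"

definition lower_tolerance :: "'e sum_problem \<Rightarrow> 'e \<Rightarrow> ereal" where
  "lower_tolerance P e =
     max_or_infinity {\<alpha>. 0 \<le> \<alpha> \<and> optimal_value (decrease_edge P e \<alpha>) = optimal_value P}"

text \<open>The vector of decreases is indexed by the elements of \<open>E\<close> instead of by an enumeration.\<close>

definition set_lower_tolerance :: "'e sum_problem \<Rightarrow> 'e set \<Rightarrow> ereal" where
  "set_lower_tolerance P E =
     max_or_infinity {\<Sum>e\<in>E. \<alpha> e | \<alpha>. (\<forall>e\<in>E. 0 \<le> \<alpha> e) \<and>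
       optimal_value (decrease_set P E \<alpha>) = optimal_value P}"

definition mstp :: "('v, 'e) ugraph \<Rightarrow> ('e \<Rightarrow> real) \<Rightarrow> 'e sum_problem" where
  "mstp G c = \<lparr>ground = edges G, feasible = spanning_trees G, cost = c\<rparr>"

end

theory Submission
  imports Defs
begin

text \<open>
  A nonnegative vector of decreases keeps the optimal value iff no feasible set gains more than its
  distance to the optimum; hence its entries are bounded by the single tolerances, and the claim is
  that the vector of all single tolerances is admissible. Spanning trees satisfy symmetric exchange,
  so a spanning tree which cannot be improved by swapping one edge is optimal. Decreasing every
  cost by its tolerance leaves an optimal tree \<open>S\<close> unimprovable by swaps, as each swap brings in one
  edge only; it also leaves the cost of \<open>S\<close> unchanged, since the edges of \<open>S\<close> have tolerance \<open>0\<close>.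

  Connectivity is expressed through cuts. If two cuts are both avoided by an edge set \<open>X\<close> and both
  crossed by \<open>f\<close>, their symmetric difference is avoided by \<open>X \<union> {f}\<close>; so if \<open>X \<union> {f}\<close> is connected,
  the two cuts agree up to complement. This gives the exchange property.
\<close>

section \<open>Tolerances under symmetric exchange\<close>

text \<open>The symmetric basis exchange property of matroids: a single \<open>f\<close> serves both
  swaps.\<close>

definition symmetric_exchange :: "'e set set \<Rightarrow> bool" where
  "symmetric_exchange D \<longleftrightarrow> (\<forall>S\<in>D. \<forall>T\<in>D. \<forall>e\<in>T - S. \<exists>f\<in>S - T.
     insert e (S - {f}) \<in> D \<and> insert f (T - {e}) \<in> D)"

lemma sum_swap:
  fixes w :: "'e \<Rightarrow> real"
  assumes "finite S" "f \<in> S" "e \<notin> S"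
  shows "sum w (insert e (S - {f})) = sum w S - w f + w e"
  using assms by (simp add: sum_diff1)

text \<open>Induction on the distance of \<open>T\<close> from \<open>S\<close>: replacing
  \<open>e\<close> by \<open>f\<close> in \<open>T\<close> moves \<open>T\<close> closer to
  \<open>S\<close>, and the mirror swap in \<open>S\<close> gives \<open>w f \<le> w e\<close>, so
  \<open>T\<close> does not get dearer.\<close>

lemma local_opt_imp_global_opt:
  fixes w :: "'e \<Rightarrow> real"
  assumes exch: "symmetric_exchange D" and fin: "\<And>T. T \<in> D \<Longrightarrow> finite T"
    and S: "S \<in> D"
    and loc: "\<And>e f. e \<notin> S \<Longrightarrow> f \<in> S \<Longrightarrow> insert e (S - {f}) \<in> D \<Longrightarrow> w f \<le> w e"
    and T: "T \<in> D"
  shows "sum w S \<le> sum w T"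
  using T
proof (induction "card (T - S)" arbitrary: T rule: less_induct)
  case less
  show ?case
  proof (cases "T \<subseteq> S")
    case True
    \<comment> \<open>An element of \<open>S - T\<close> would need an exchange partner in the empty
      set \<open>T - S\<close>.\<close>
    have "S \<subseteq> T"
      using exch less.prems S True unfolding symmetric_exchange_def by blast
    with True show ?thesis by simp
  next
    case False
    then obtain e where e: "e \<in> T" "e \<notin> S" by blast
    then have "\<exists>f\<in>S - T. insert e (S - {f}) \<in> D \<and> insert f (T - {e}) \<in> D"
      using exch less.prems S by (simp add: symmetric_exchange_def)
    then obtain f where f: "f \<in> S" "f \<notin> T"
      and D: "insert e (S - {f}) \<in> D" "insert f (T - {e}) \<in> D"
      by blast
    have "insert f (T - {e}) - S = T - S - {e}" using f(1) by auto
    then have "card (insert f (T - {e}) - S) < card (T - S)"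
      using fin[OF less.prems] e by (simp only:) (intro card_Diff1_less, auto)
    then have "sum w S \<le> sum w (insert f (T - {e}))"
      using D(2) less.hyps by blast
    also have "\<dots> = sum w T - w e + w f"
      using sum_swap fin[OF less.prems] e f by metis
    finally show ?thesis using loc[OF e(2) f(1) D(1)] by simp
  qed
qed

section \<open>Tolerances as maxima\<close>

lemma max_or_infinity_greatest:
  assumes "m \<in> A" "\<And>x. x \<in> A \<Longrightarrow> x \<le> m"
  shows "max_or_infinity A = ereal m"
proof -
  have "bdd_above A" using assms(2) by (rule bdd_aboveI)
  moreover have "(GREATEST x. x \<in> A) = m" using assms by (rule Greatest_equality)
  ultimately show ?thesis by (simp add: max_or_infinity_def)
qed

lemma max_or_infinity_unbounded:
  assumes "\<And>x. 0 \<le> x \<Longrightarrow> \<exists>y\<in>A. x \<le> y"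
  shows "max_or_infinity A = \<infinity>"
proof -
  have "\<not> bdd_above A"
  proof
    assume "bdd_above A"
    then obtain M where M: "\<And>x. x \<in> A \<Longrightarrow> x \<le> M" by (auto simp: bdd_above_def)
    obtain y where "y \<in> A" "max 0 M + 1 \<le> y" using assms[of "max 0 M + 1"] by auto
    with M[of y] show False by simp
  qed
  then show ?thesis by (simp add: max_or_infinity_def)
qed

lemma decrease_edge_eq_decrease_set:
  "decrease_edge P e a = decrease_set P {e} (\<lambda>_. a)"
proof -
  have "(cost P)(e := cost P e - a) = (\<lambda>x. if x \<in> {e} then cost P x - a else cost P x)" by auto
  then show ?thesis by (simp add: decrease_edge_def decrease_set_def)
qed

lemma objective_decrease_set:
  assumes "finite T"
  shows "objective (decrease_set P E \<alpha>) T = objective P T - sum \<alpha> (E \<inter> T)"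
proof -
  have "objective (decrease_set P E \<alpha>) T = (\<Sum>e\<in>T. cost P e - (if e \<in> E then \<alpha> e else 0))"
    by (auto simp: objective_def decrease_set_def intro!: sum.cong)
  also have "\<dots> = objective P T - sum \<alpha> (T \<inter> E)"
    using assms by (simp add: sum_subtractf objective_def sum.inter_restrict)
  finally show ?thesis by (simp add: Int_commute)
qed

lemma optimal_value_attained:
  assumes "finite (feasible P)" "feasible P \<noteq> {}"
  obtains S where "S \<in> feasible P" "optimal_value P = objective P S"
proof -
  have "optimal_value P \<in> objective P ` feasible P"
    using assms unfolding optimal_value_def by (intro Min_in) auto
  then show ?thesis using that by blast
qed

text \<open>An optimal set of \<open>P\<close> does not become dearer, so the optimum cannot rise;
  it stays iff no feasible set falls below the old value.\<close>

lemma optimal_value_decrease_set_eq_iff: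
  assumes D: "finite (feasible P)" "feasible P \<noteq> {}"
    and fin: "\<And>T. T \<in> feasible P \<Longrightarrow> finite T"
    and nonneg: "\<And>e. e \<in> E \<Longrightarrow> 0 \<le> \<alpha> e"
  shows "optimal_value (decrease_set P E \<alpha>) = optimal_value P \<longleftrightarrow>
    (\<forall>T\<in>feasible P. sum \<alpha> (E \<inter> T) \<le> objective P T - optimal_value P)"
proof -
  let ?Q = "decrease_set P E \<alpha>"
  have feas: "feasible ?Q = feasible P" by (simp add: decrease_set_def)
  obtain S where S: "S \<in> feasible P" "optimal_value P = objective P S"
    using optimal_value_attained[OF D] by blast
  have "optimal_value ?Q \<le> objective ?Q S"
    using D S feas unfolding optimal_value_def by auto
  also have "\<dots> \<le> optimal_value P"
    using S fin nonneg by (auto simp: objective_decrease_set intro!: sum_nonneg)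
  finally have "optimal_value ?Q = optimal_value P \<longleftrightarrow> optimal_value P \<le> optimal_value ?Q"
    by auto
  also have "\<dots> \<longleftrightarrow> (\<forall>T\<in>feasible P. optimal_value P \<le> objective ?Q T)"
    using D feas unfolding optimal_value_def[of ?Q] by simp
  also have "\<dots> \<longleftrightarrow> (\<forall>T\<in>feasible P. sum \<alpha> (E \<inter> T) \<le> objective P T - optimal_value P)"
    using fin by (intro ball_cong) (auto simp: objective_decrease_set)
  finally show ?thesis .
qed

text \<open>Of the combinatorics of trees only \<open>symmetric_exchange\<close> enters. An infinite
  tolerance means that the element lies in no feasible set, whence the case split.\<close>

theorem sum_lower_tolerance_eq_set_lower_tolerance:
  assumes D: "finite (feasible P)" "feasible P \<noteq> {}"
    and fin: "\<And>T. T \<in> feasible P \<Longrightarrow> finite T"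
    and exch: "symmetric_exchange (feasible P)"
    and E: "finite E"
  shows "(\<Sum>e\<in>E. lower_tolerance P e) = set_lower_tolerance P E"
proof -
  let ?z = "optimal_value P"
  have iff: "optimal_value (decrease_set P F \<alpha>) = ?z \<longleftrightarrow>
      (\<forall>T\<in>feasible P. sum \<alpha> (F \<inter> T) \<le> objective P T - ?z)"
    if "\<And>e. e \<in> F \<Longrightarrow> 0 \<le> \<alpha> e" for F \<alpha>
    by (rule optimal_value_decrease_set_eq_iff) (use D fin that in auto)
  have opt: "?z \<le> objective P T" if "T \<in> feasible P" for T
    using D that unfolding optimal_value_def by auto
  have single: "lower_tolerance P e = max_or_infinity
      {a. 0 \<le> a \<and> (\<forall>T\<in>feasible P. e \<in> T \<longrightarrow> a \<le> objective P T - ?z)}" for e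
  proof -
    have "optimal_value (decrease_edge P e a) = ?z \<longleftrightarrow>
        (\<forall>T\<in>feasible P. e \<in> T \<longrightarrow> a \<le> objective P T - ?z)" if "0 \<le> a" for a
    proof -
      \<comment> \<open>Sets without \<open>e\<close> only demand that their distance to the optimum
        is nonnegative, which is \<open>opt\<close>.\<close>
      have "sum (\<lambda>_. a) ({e} \<inter> T) = (if e \<in> T then a else 0)" for T by simp
      then show ?thesis
        using iff[of "{e}" "\<lambda>_. a"] that opt
        unfolding decrease_edge_eq_decrease_set by (metis diff_ge_0_iff_ge)
    qed
    then show ?thesis unfolding lower_tolerance_def by (intro arg_cong[of _ _ max_or_infinity]) auto
  qed
  define A where "A = {\<Sum>e\<in>E. \<alpha> e | \<alpha>. (\<forall>e\<in>E. 0 \<le> \<alpha> e) \<and>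
      (\<forall>T\<in>feasible P. sum \<alpha> (E \<inter> T) \<le> objective P T - ?z)}"
  have set: "set_lower_tolerance P E = max_or_infinity A"
    unfolding set_lower_tolerance_def A_def
    by (intro arg_cong[of _ _ max_or_infinity] Collect_cong) (use iff in blast)
  show ?thesis
  proof (cases "\<exists>e\<in>E. \<forall>T\<in>feasible P. e \<notin> T")
    case True
    then obtain e where e: "e \<in> E" "\<And>T. T \<in> feasible P \<Longrightarrow> e \<notin> T" by blast
    have "lower_tolerance P e = \<infinity>"
      unfolding single using e(2) by (intro max_or_infinity_unbounded) auto
    then have "(\<Sum>e\<in>E. lower_tolerance P e) = \<infinity>"
      using E e(1) by (auto simp: sum_Pinfty)
    moreover have "max_or_infinity A = \<infinity>"
    proof (rule max_or_infinity_unbounded)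
      fix x :: real assume x: "0 \<le> x"
      \<comment> \<open>The whole decrease goes to \<open>e\<close>, which no feasible set contains,
        so no objective value changes although the total is arbitrarily large.\<close>
      let ?\<alpha> = "\<lambda>e'. if e' = e then x else 0"
      have "sum ?\<alpha> (E \<inter> T) = 0" if "T \<in> feasible P" for T
        using e(2)[OF that] by (intro sum.neutral) auto
      moreover have "sum ?\<alpha> E = x" using E e(1) by simp
      ultimately have "x \<in> A"
        unfolding A_def using x opt by (intro CollectI exI[of _ ?\<alpha>]) auto
      then show "\<exists>y\<in>A. x \<le> y" by blast
    qed
    ultimately show ?thesis using set by simp
  next
    case False
    \<comment> \<open>The surcharge over the optimum of a cheapest feasible set containing
      \<open>e\<close>. For \<open>e \<in> E\<close> the minimum is over a nonempty set by the case
      assumption.\<close>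
    define t where "t e = Min (objective P ` {T \<in> feasible P. e \<in> T}) - ?z" for e
    have t_le: "t e \<le> objective P T - ?z" if "T \<in> feasible P" "e \<in> T" for e T
      using D that unfolding t_def by auto
    have t_att: "\<exists>T\<in>feasible P. e \<in> T \<and> t e = objective P T - ?z" if "e \<in> E" for e
      using Min_in[of "objective P ` {T \<in> feasible P. e \<in> T}"] D False that
      unfolding t_def by fastforce
    have t_nonneg: "0 \<le> t e" if "e \<in> E" for e
      using t_att[OF that] opt by force
    have tol: "lower_tolerance P e = ereal (t e)" if "e \<in> E" for e
    proof -
      obtain T where T: "T \<in> feasible P" "e \<in> T" "t e = objective P T - ?z"
        using t_att[OF \<open>e \<in> E\<close>] by blast
      have "t e \<in> {a. 0 \<le> a \<and> (\<forall>T\<in>feasible P. e \<in> T \<longrightarrow> a \<le> objective P T - ?z)}"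
        using t_le t_nonneg[OF \<open>e \<in> E\<close>] by blast
      moreover have "a \<le> t e"
        if "a \<in> {a. 0 \<le> a \<and> (\<forall>T\<in>feasible P. e \<in> T \<longrightarrow> a \<le> objective P T - ?z)}" for a
        using that T by simp
      ultimately show ?thesis unfolding single by (rule max_or_infinity_greatest)
    qed
    obtain S where S: "S \<in> feasible P" "?z = objective P S"
      using optimal_value_attained[OF D] by blast
    define w where "w e = cost P e - (if e \<in> E then t e else 0)" for e
    have wsum: "sum w T = objective P T - sum t (E \<inter> T)" if "T \<in> feasible P" for T
      using fin[OF that]
      by (simp add: w_def sum_subtractf objective_def sum.inter_restrict Int_commute[of E])
    \<comment> \<open>\<open>S\<close> itself is a feasible set through \<open>e\<close> without
      surcharge.\<close>
    have t0: "t e = 0" if "e \<in> E" "e \<in> S" for e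
      using t_le[OF S(1) that(2)] t_nonneg[OF that(1)] S(2) by simp
    have adm: "sum t (E \<inter> T) \<le> objective P T - ?z" if "T \<in> feasible P" for T
    proof -
      \<comment> \<open>The swapped set contains \<open>e\<close>, so for \<open>e \<in> E\<close>
        its surcharge \<open>cost P e - cost P f\<close> is at least \<open>t e\<close>; for other
        \<open>e\<close> the optimality of \<open>S\<close> suffices. As \<open>f \<in> S\<close>,
        \<open>w f\<close> is the old cost of \<open>f\<close>.\<close>
      have "w f \<le> w e" if "e \<notin> S" "f \<in> S" "insert e (S - {f}) \<in> feasible P" for e f
      proof -
        have "objective P (insert e (S - {f})) = ?z - cost P f + cost P e"
          using sum_swap[OF fin[OF S(1)] that(2,1)] S(2) by (simp add: objective_def)
        then show ?thesis
          using t_le[OF that(3), of e] opt[OF that(3)] t0[of f] that(2) by (auto simp: w_def)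
      qed
      then have "sum w S \<le> sum w T"
        using local_opt_imp_global_opt[OF exch fin S(1) _ that] by blast
      \<comment> \<open>The tolerances vanish on \<open>S\<close>, so \<open>S\<close> still costs
        \<open>?z\<close>, and its optimality for \<open>w\<close> is the admissibility of
        \<open>t\<close>.\<close>
      moreover have "sum t (E \<inter> S) = 0" using t0 by (intro sum.neutral) auto
      ultimately show ?thesis using wsum that S by simp
    qed
    have "max_or_infinity A = ereal (sum t E)"
    proof (rule max_or_infinity_greatest)
      show "sum t E \<in> A" unfolding A_def using adm t_nonneg by blast
    next
      fix x assume "x \<in> A"
      then obtain \<alpha> where x: "x = sum \<alpha> E" and nn: "\<And>e. e \<in> E \<Longrightarrow> 0 \<le> \<alpha> e"
        and le: "\<And>T. T \<in> feasible P \<Longrightarrow> sum \<alpha> (E \<inter> T) \<le> objective P T - ?z"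
        unfolding A_def by blast
      have "\<alpha> e \<le> t e" if e: "e \<in> E" for e
      proof -
        obtain T where T: "T \<in> feasible P" "e \<in> T" "t e = objective P T - ?z"
          using t_att[OF e] by blast
        have "\<alpha> e \<le> sum \<alpha> (E \<inter> T)"
          using E e T(2) nn by (intro member_le_sum) auto
        with le[OF T(1)] T(3) show ?thesis by simp
      qed
      then show "x \<le> sum t E" unfolding x by (rule sum_mono)
    qed
    then show ?thesis using set tol by simp
  qed
qed

section \<open>Spanning trees as minimal connected edge sets\<close>

definition crosses :: "('v, 'e) ugraph \<Rightarrow> 'v set \<Rightarrow> 'e \<Rightarrow> bool" where
  "crosses G A e \<longleftrightarrow> ends G e \<inter> A \<noteq> {} \<and> ends G e - A \<noteq> {}"

text \<open>Connectivity through cuts instead of walks. \<open>A\<close> need not lie inside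
  \<open>verts G\<close>; only its trace there has to be nonempty and proper.\<close>

definition connecting :: "('v, 'e) ugraph \<Rightarrow> 'e set \<Rightarrow> bool" where
  "connecting G X \<longleftrightarrow> X \<subseteq> edges G \<and>
     (\<forall>A. verts G \<inter> A \<noteq> {} \<and> verts G - A \<noteq> {} \<longrightarrow> (\<exists>e\<in>X. crosses G A e))"

definition minimal_connecting :: "('v, 'e) ugraph \<Rightarrow> 'e set \<Rightarrow> bool" where
  "minimal_connecting G X \<longleftrightarrow> connecting G X \<and> (\<forall>e\<in>X. \<not> connecting G (X - {e}))"

section \<open>Cuts and connectivity\<close>

lemma edge_ends:
  assumes "finite_ugraph G" "e \<in> edges G"
  obtains u v where "ends G e = {u, v}" "u \<in> verts G" "v \<in> verts G"
proof -
  from assms have "ends G e \<subseteq> verts G" "card (ends G e) \<in> {1, 2}"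
    by (auto simp: finite_ugraph_def)
  then show ?thesis
    using that by (auto simp: card_1_singleton_iff card_2_iff)
qed

lemma crosses_ends: "ends G e = {u, v} \<Longrightarrow> crosses G A e \<longleftrightarrow> (u \<in> A) \<noteq> (v \<in> A)"
  by (auto simp: crosses_def)

text \<open>Crossing is additive modulo 2: an edge crosses a set iff the indicator function of the
  set differs at its ends.\<close>

lemma crosses_sym_diff:
  assumes "finite_ugraph G" "e \<in> edges G"
  shows "crosses G ((A - B) \<union> (B - A)) e \<longleftrightarrow> crosses G A e \<noteq> crosses G B e"
proof -
  obtain u v where "ends G e = {u, v}" using edge_ends[OF assms] by metis
  then show ?thesis by (auto simp: crosses_ends)
qed

lemma crosses_verts:
  assumes "finite_ugraph G" "e \<in> edges G" "crosses G A e"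
  shows "verts G \<inter> A \<noteq> {}" "verts G - A \<noteq> {}"
  using assms by (auto simp: finite_ugraph_def crosses_def)

lemma rtrancl_leaves_set:
  assumes "(u, v) \<in> r\<^sup>*" "u \<in> A" "v \<notin> A"
  shows "\<exists>x y. (x, y) \<in> r \<and> x \<in> A \<and> y \<notin> A"
  using assms by (induction rule: rtrancl_induct) blast+

text \<open>A walk from inside \<open>A\<close> to outside leaves \<open>A\<close> along some edge;
  conversely, the set of vertices reachable from \<open>u\<close> is a cut that no edge of
  \<open>X\<close> crosses.\<close>

lemma connected_iff_connecting:
  assumes G: "finite_ugraph G" "verts G \<noteq> {}" and X: "X \<subseteq> edges G"
  shows "connected_ugraph (G\<lparr>edges := X\<rparr>) \<longleftrightarrow> connecting G X"
proof
  let ?H = "G\<lparr>edges := X\<rparr>"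
  assume conn: "connected_ugraph ?H"
  show "connecting G X"
    unfolding connecting_def
  proof (intro conjI allI impI X)
    fix A assume "verts G \<inter> A \<noteq> {} \<and> verts G - A \<noteq> {}"
    then obtain u v where uv: "u \<in> verts G" "u \<in> A" "v \<in> verts G" "v \<notin> A" by blast
    then have "(u, v) \<in> (adjacency ?H)\<^sup>*" using conn by (simp add: connected_ugraph_def)
    from rtrancl_leaves_set[OF this uv(2,4)] obtain x y
      where xy: "(x, y) \<in> adjacency ?H" "x \<in> A" "y \<notin> A" by blast
    then obtain e where "e \<in> X" "ends G e = {x, y}" by (auto simp: adjacency_def)
    moreover from this xy have "crosses G A e" by (simp add: crosses_ends)
    ultimately show "\<exists>e\<in>X. crosses G A e" by blast
  qed
next
  let ?H = "G\<lparr>edges := X\<rparr>"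
  assume conn: "connecting G X"
  have "(u, v) \<in> (adjacency ?H)\<^sup>*" if u: "u \<in> verts G" and v: "v \<in> verts G" for u v
  proof (rule ccontr)
    assume nv: "(u, v) \<notin> (adjacency ?H)\<^sup>*"
    define A where "A = {w. (u, w) \<in> (adjacency ?H)\<^sup>*}"
    have "verts G \<inter> A \<noteq> {} \<and> verts G - A \<noteq> {}" using u v nv by (auto simp: A_def)
    then obtain e where e: "e \<in> X" "crosses G A e" using conn by (auto simp: connecting_def)
    then obtain p q where pq: "ends G e = {p, q}" using X edge_ends[OF G(1)] by (metis subsetD)
    have "(p, q) \<in> adjacency ?H" "(q, p) \<in> adjacency ?H"
      using e(1) pq by (auto simp: adjacency_def)
    then have "p \<in> A \<longleftrightarrow> q \<in> A" unfolding A_def by (auto intro: rtrancl_into_rtrancl)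
    with e(2) pq show False by (simp add: crosses_ends)
  qed
  with G show "connected_ugraph ?H" by (simp add: connected_ugraph_def)
qed

section \<open>Cycles and removable edges\<close>

text \<open>The path grows edge by edge; if the new vertex already occurs, the path is cut off there
  instead, so its vertices stay distinct.\<close>

lemma rtrancl_adjacency_path:
  assumes "(u, v) \<in> (adjacency G)\<^sup>*"
  obtains vs es where "vs \<noteq> []" "distinct vs" "hd vs = u" "last vs = v"
    "Suc (length es) = length vs" "set es \<subseteq> edges G"
    "\<And>i. i < length es \<Longrightarrow> ends G (es ! i) = {vs ! i, vs ! Suc i}"
  using assms
proof (induction arbitrary: thesis rule: rtrancl_induct)
  case base
  show ?case by (rule base(1)[of "[u]" "[]"]) auto
next
  case (step y z)
  obtain vs es where p: "vs \<noteq> []" "distinct vs" "hd vs = u" "last vs = y"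
    "Suc (length es) = length vs" "set es \<subseteq> edges G"
    and ends: "\<And>i. i < length es \<Longrightarrow> ends G (es ! i) = {vs ! i, vs ! Suc i}"
    using step.IH by blast
  obtain e where e: "e \<in> edges G" "ends G e = {y, z}"
    using step.hyps(2) by (auto simp: adjacency_def)
  show ?case
  proof (cases "z \<in> set vs")
    case True
    then obtain k where k: "k < length vs" "vs ! k = z" by (auto simp: in_set_conv_nth)
    show ?thesis
    proof (rule step.prems[of "take (Suc k) vs" "take k es"])
      show "last (take (Suc k) vs) = z" using k by (simp add: take_Suc_conv_app_nth)
      show "set (take k es) \<subseteq> edges G" using p(6) by (meson set_take_subset subset_trans)
    qed (use p k ends in auto)
  next
    case False
    have y: "vs ! length es = y"
      using p(1,4) p(5)[symmetric] by (simp add: last_conv_nth)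
    show ?thesis
    proof (rule step.prems[of "vs @ [z]" "es @ [e]"])
      fix i assume "i < length (es @ [e])"
      then consider "i < length es" | "i = length es" by force
      then show "ends G ((es @ [e]) ! i) = {(vs @ [z]) ! i, (vs @ [z]) ! Suc i}"
      proof cases
        case 1
        then show ?thesis using ends[OF 1] p(5) by (simp add: nth_append)
      next
        case 2
        then show ?thesis using e(2) p(5) y by (simp add: nth_append)
      qed
    qed (use p e False in auto)
  qed
qed

text \<open>The ends of a removable \<open>e\<close> are still joined by a path avoiding
  \<open>e\<close>, and \<open>e\<close> closes this path. For a loop the path has no edges.\<close>

lemma removable_imp_cycle:
  assumes G: "finite_ugraph G" "verts G \<noteq> {}" and X: "X \<subseteq> edges G" and e: "e \<in> X"
    and conn: "connecting G (X - {e})"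
  shows "\<exists>vs es. is_cycle (G\<lparr>edges := X\<rparr>) vs es"
proof -
  let ?H = "G\<lparr>edges := X - {e}\<rparr>"
  obtain u v where uv: "ends G e = {u, v}" "u \<in> verts G" "v \<in> verts G"
    using edge_ends[OF G(1)] X e by blast
  have "connected_ugraph ?H"
    using connected_iff_connecting[OF G, of "X - {e}"] X conn by blast
  then have "(u, v) \<in> (adjacency ?H)\<^sup>*" using uv by (simp add: connected_ugraph_def)
  then obtain vs es where p: "vs \<noteq> []" "distinct vs" "hd vs = u" "last vs = v"
    "Suc (length es) = length vs" "set es \<subseteq> X - {e}"
    and ends: "\<And>i. i < length es \<Longrightarrow> ends G (es ! i) = {vs ! i, vs ! Suc i}"
    by (rule rtrancl_adjacency_path) auto
  have lst: "vs ! length es = v"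
    using p(1,4) p(5)[symmetric] by (simp add: last_conv_nth)
  have first: "vs ! 0 = u" using p(1,3) by (simp add: hd_conv_nth)
  have "distinct es"
    unfolding distinct_conv_nth
  proof (intro allI impI)
    fix i j assume ij: "i < length es" "j < length es" "i \<noteq> j"
    have inj: "vs ! a = vs ! b \<longleftrightarrow> a = b" if "a \<le> length es" "b \<le> length es" for a b
      using p(2,5) that by (simp add: nth_eq_iff_index_eq)
    have "{vs ! i, vs ! Suc i} \<noteq> {vs ! j, vs ! Suc j}"
      using ij by (auto simp: doubleton_eq_iff inj)
    then show "es ! i \<noteq> es ! j" using ends ij by metis
  qed
  moreover have "set vs \<subseteq> verts G"
  proof
    fix x assume "x \<in> set vs"
    then obtain i where i: "i < length vs" "vs ! i = x" by (auto simp: in_set_conv_nth)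
    show "x \<in> verts G"
    proof (cases "i = length es")
      case True
      then show ?thesis using i lst uv by simp
    next
      case False
      then have "i < length es" using i p(5) by simp
      then have "x \<in> ends G (es ! i)" "es ! i \<in> edges G"
        using ends i p(6) X nth_mem by auto blast
      then show ?thesis using G by (auto simp: finite_ugraph_def)
    qed
  qed
  \<comment> \<open>At the last index the successor wraps around to \<open>0\<close>, where the
    closing edge \<open>e\<close> returns to \<open>u\<close>.\<close>
  moreover have "ends G ((es @ [e]) ! i) = {vs ! i, vs ! (Suc i mod length vs)}"
    if "i < length vs" for i
  proof (cases "i = length es")
    case True
    then show ?thesis using p(5) lst first uv by (simp add: nth_append insert_commute)
  next
    case False
    then have "i < length es" using that p(5) by simp
    then show ?thesis using ends p(5) by (simp add: nth_append)
  qed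
  ultimately have "is_cycle (G\<lparr>edges := X\<rparr>) vs (es @ [e])"
    using p e by (auto simp: is_cycle_def)
  then show ?thesis by blast
qed

text \<open>No cut is crossed by exactly one edge of a cycle, so any one cycle edge can go; the last
  is taken here.\<close>

lemma cycle_imp_removable:
  assumes conn: "connecting G X" and cyc: "is_cycle (G\<lparr>edges := X\<rparr>) vs es"
  shows "\<exists>e\<in>X. connecting G (X - {e})"
proof -
  define n where "n = length vs - 1"
  have n: "length vs = Suc n" "length es = Suc n"
    using cyc by (auto simp: is_cycle_def n_def)
  have sub: "set es \<subseteq> X" and dist: "distinct es" using cyc by (auto simp: is_cycle_def)
  have ends: "ends G (es ! i) = {vs ! i, vs ! (Suc i mod Suc n)}" if "i \<le> n" for i
    using cyc that n by (auto simp: is_cycle_def)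
  have in_X: "es ! i \<in> X" if "i \<le> n" for i using that n sub by (auto simp: subset_iff)
  let ?e = "es ! n"
  have "connecting G (X - {?e})"
    unfolding connecting_def
  proof (intro conjI allI impI)
    show "X - {?e} \<subseteq> edges G" using conn by (auto simp: connecting_def)
    fix A assume A: "verts G \<inter> A \<noteq> {} \<and> verts G - A \<noteq> {}"
    show "\<exists>e\<in>X - {?e}. crosses G A e"
    proof (rule ccontr)
      assume no: "\<not> (\<exists>e\<in>X - {?e}. crosses G A e)"
      have same_side: "vs ! i \<in> A \<longleftrightarrow> vs ! 0 \<in> A" if "i \<le> n" for i
        using that
      proof (induction i)
        case (Suc i)
        have "es ! i \<noteq> ?e" using dist n Suc.prems by (simp add: nth_eq_iff_index_eq)
        then have "\<not> crosses G A (es ! i)" using no in_X Suc.prems by auto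
        moreover have "ends G (es ! i) = {vs ! i, vs ! Suc i}" using ends[of i] Suc.prems by simp
        ultimately show ?case using Suc by (simp add: crosses_ends)
      qed simp
      have "ends G ?e = {vs ! n, vs ! 0}" using ends[of n] by simp
      then have "\<not> crosses G A ?e" using same_side[of n] by (simp add: crosses_ends)
      with no have "\<not> (\<exists>e\<in>X. crosses G A e)" by blast
      with conn A show False by (simp add: connecting_def)
    qed
  qed
  with in_X show ?thesis by blast
qed

lemma spanning_trees_eq:
  assumes "finite_ugraph G" "verts G \<noteq> {}"
  shows "spanning_trees G = {X. minimal_connecting G X}"
proof -
  have "X \<subseteq> edges G \<and> tree_ugraph (G\<lparr>edges := X\<rparr>) \<longleftrightarrow> minimal_connecting G X" for X
  proof (cases "X \<subseteq> edges G")
    case True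
    show ?thesis
      using connected_iff_connecting[OF assms True] removable_imp_cycle[OF assms True]
        cycle_imp_removable[of G X] True
      unfolding tree_ugraph_def minimal_connecting_def by blast
  qed (auto simp: minimal_connecting_def connecting_def)
  then show ?thesis by (simp add: spanning_trees_def)
qed

lemma minimal_connecting_exists:
  assumes "finite X" "connecting G X"
  shows "\<exists>Y. minimal_connecting G Y"
  using assms
proof (induction X rule: finite_psubset_induct)
  case (psubset X)
  then show ?case unfolding minimal_connecting_def by (metis Diff_subset psubsetI Diff_iff insertI1)
qed

section \<open>The exchange property\<close>

text \<open>\<open>X\<close> avoids \<open>A\<close>, so \<open>f\<close> is what joins the two
  sides of \<open>A\<close>, and \<open>e\<close> can do the same.\<close>

lemma connecting_exchange:
  assumes G: "finite_ugraph G" and conn: "connecting G (insert f X)"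
    and e: "e \<in> edges G" "crosses G A e" and no: "\<And>x. x \<in> X \<Longrightarrow> \<not> crosses G A x"
  shows "connecting G (insert e X)"
  unfolding connecting_def
proof (intro conjI allI impI)
  have X: "X \<subseteq> edges G" "f \<in> edges G" using conn by (auto simp: connecting_def)
  then show "insert e X \<subseteq> edges G" using e by simp
  have cut: "\<exists>x\<in>insert f X. crosses G C x" if "verts G \<inter> C \<noteq> {}" "verts G - C \<noteq> {}" for C
    using conn that by (simp add: connecting_def)
  fix B assume B: "verts G \<inter> B \<noteq> {} \<and> verts G - B \<noteq> {}"
  show "\<exists>x\<in>insert e X. crosses G B x"
  proof (rule ccontr)
    assume nB: "\<not> (\<exists>x\<in>insert e X. crosses G B x)"
    \<comment> \<open>\<open>f\<close> crosses \<open>A\<close> and \<open>B\<close>, hence not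
      \<open>?C\<close>, which \<open>X\<close> avoids too; yet \<open>e\<close> crosses
      \<open>?C\<close>, as it crosses \<open>A\<close> but not \<open>B\<close>. So
      \<open>?C\<close> is a proper cut that \<open>insert f X\<close> misses.\<close>
    let ?C = "(A - B) \<union> (B - A)"
    have "crosses G A f" using cut[OF crosses_verts[OF G e]] no by blast
    moreover have "crosses G B f" using cut[of B] B nB by blast
    ultimately have "\<not> crosses G ?C x" if "x \<in> insert f X" for x
      using that no nB X crosses_sym_diff[OF G, of x A B] by blast
    moreover have "crosses G ?C e" using e nB crosses_sym_diff[OF G e(1)] by blast
    ultimately show False using cut[OF crosses_verts[OF G e(1)]] by blast
  qed
qed

lemma minimal_connecting_exchange:
  assumes G: "finite_ugraph G" and T: "minimal_connecting G T" and e: "e \<in> T"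
    and A: "\<And>x. x \<in> T - {e} \<Longrightarrow> \<not> crosses G A x" "crosses G A e"
    and f: "f \<in> edges G" "crosses G A f"
  shows "minimal_connecting G (insert f (T - {e}))"
proof -
  have Te: "e \<in> edges G" "connecting G (insert e (T - {e}))"
    using T e by (auto simp: minimal_connecting_def connecting_def insert_absorb)
  have "\<not> connecting G (insert f (T - {e}) - {g})" if "g \<in> insert f (T - {e})" for g
  proof
    assume c: "connecting G (insert f (T - {e}) - {g})"
    show False
    proof (cases "g = f")
      case True
      then have "insert f (T - {e}) - {g} \<subseteq> T - {e}" by blast
      then have "\<not> (\<exists>x\<in>insert f (T - {e}) - {g}. crosses G A x)" using A by blast
      with c crosses_verts[OF G f] show False by (auto simp: connecting_def)
    next
      case False
      then have g: "g \<in> T" "g \<noteq> e" using that by auto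
      have "insert f (T - {e}) - {g} = insert f (T - {e} - {g})" using False by blast
      with c have "connecting G (insert f (T - {e} - {g}))" by simp
      then have "connecting G (insert e (T - {e} - {g}))"
        by (rule connecting_exchange[OF G _ Te(1) A(2)]) (use A(1) in blast)
      moreover have "insert e (T - {e} - {g}) = T - {g}" using e g by blast
      ultimately show False using T g by (simp add: minimal_connecting_def)
    qed
  qed
  moreover have "connecting G (insert f (T - {e}))"
    by (rule connecting_exchange[OF G Te(2) f]) (use A(1) in blast)
  ultimately show ?thesis by (simp add: minimal_connecting_def)
qed

text \<open>The fundamental cut of \<open>e\<close> with respect to \<open>X\<close>: deleting
  \<open>e\<close> leaves some cut uncrossed, and only \<open>e\<close> can have crossed it.\<close>

lemma minimal_connecting_cut:
  assumes "minimal_connecting G X" "e \<in> X"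
  obtains A where "crosses G A e" "\<And>x. x \<in> X - {e} \<Longrightarrow> \<not> crosses G A x"
proof -
  have conn: "connecting G X" and "\<not> connecting G (X - {e})"
    using assms by (auto simp: minimal_connecting_def)
  then obtain A where A: "verts G \<inter> A \<noteq> {}" "verts G - A \<noteq> {}"
    "\<not> (\<exists>x\<in>X - {e}. crosses G A x)"
    unfolding connecting_def by blast
  moreover have "\<exists>x\<in>X. crosses G A x" using conn A(1,2) by (simp add: connecting_def)
  ultimately show ?thesis using that[of A] by blast
qed

text \<open>
  In terms of trees, \<open>f\<close> is an edge of the fundamental cycle of \<open>e\<close> which crosses the cut \<open>A\<close>.
\<close>

lemma crossing_edge_with_cut:
  assumes G: "finite_ugraph G" and S: "minimal_connecting G S"
    and e: "e \<in> edges G" "crosses G A e"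
  shows "\<exists>f\<in>S. crosses G A f \<and> (\<exists>B. crosses G B f \<and> crosses G B e \<and>
    (\<forall>x\<in>S - {f}. \<not> crosses G B x))"
  using e(2)
proof (induction "card {x \<in> S. crosses G A x}" arbitrary: A rule: less_induct)
  case less
  have S': "connecting G S" "S \<subseteq> edges G" "finite S"
    using S G
    by (auto simp: minimal_connecting_def connecting_def finite_ugraph_def intro: finite_subset)
  obtain f where f: "f \<in> S" "crosses G A f"
    using S'(1) crosses_verts[OF G e(1) less.prems] by (auto simp: connecting_def)
  obtain B where B: "crosses G B f" "\<And>x. x \<in> S - {f} \<Longrightarrow> \<not> crosses G B x"
    using minimal_connecting_cut[OF S f(1)] by metis
  show ?case
  proof (cases "crosses G B e")
    case True
    with f B show ?thesis by blast
  next
    case False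
    \<comment> \<open>Adding \<open>B\<close> to \<open>A\<close> modulo 2 removes \<open>f\<close>
      and nothing else from the edges of \<open>S\<close> across the cut, and \<open>e\<close> still
      crosses it, so the induction applies; an edge of \<open>S\<close> found for \<open>?C\<close>
      also crosses \<open>A\<close>.\<close>
    let ?C = "(A - B) \<union> (B - A)"
    have C: "crosses G ?C x \<longleftrightarrow> crosses G A x \<and> x \<noteq> f" if "x \<in> S" for x
      using crosses_sym_diff[OF G, of x A B] that S'(2) B f by blast
    have "{x \<in> S. crosses G ?C x} \<subset> {x \<in> S. crosses G A x}" using C f by blast
    then have "card {x \<in> S. crosses G ?C x} < card {x \<in> S. crosses G A x}"
      using S'(3) by (intro psubset_card_mono) auto
    moreover have "crosses G ?C e" using crosses_sym_diff[OF G e(1)] less.prems False by blast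
    ultimately show ?thesis using less.hyps[of ?C] C by blast
  qed
qed

text \<open>With \<open>A\<close> the fundamental cut of \<open>e\<close> in \<open>T\<close> and
  \<open>B\<close> that of \<open>f\<close> in \<open>S\<close>, both \<open>e\<close> and
  \<open>f\<close> cross both cuts, so each can replace the other.\<close>

lemma symmetric_exchange_minimal_connecting:
  assumes G: "finite_ugraph G"
  shows "symmetric_exchange {X. minimal_connecting G X}"
proof -
  have "\<exists>f\<in>S - T. minimal_connecting G (insert e (S - {f})) \<and>
      minimal_connecting G (insert f (T - {e}))"
    if S: "minimal_connecting G S" and T: "minimal_connecting G T" and e: "e \<in> T - S" for S T e
  proof -
    have eT: "e \<in> T" and eG: "e \<in> edges G"
      using T e by (auto simp: minimal_connecting_def connecting_def)
    obtain A where A: "crosses G A e" "\<And>x. x \<in> T - {e} \<Longrightarrow> \<not> crosses G A x"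
      using minimal_connecting_cut[OF T eT] by metis
    obtain f B where f: "f \<in> S" "crosses G A f"
      and B: "crosses G B f" "crosses G B e" "\<And>x. x \<in> S - {f} \<Longrightarrow> \<not> crosses G B x"
      using crossing_edge_with_cut[OF G S eG A(1)] by blast
    have fG: "f \<in> edges G" using S f by (auto simp: minimal_connecting_def connecting_def)
    \<comment> \<open>In \<open>T\<close> only \<open>e\<close> crosses \<open>A\<close>, and
      \<open>f\<close> differs from \<open>e\<close> because \<open>e \<notin> S\<close>.\<close>
    have "f \<notin> T" using A(2) f e by blast
    moreover have "minimal_connecting G (insert e (S - {f}))"
      by (rule minimal_connecting_exchange[OF G S f(1) B(3) B(1) eG B(2)])
    moreover have "minimal_connecting G (insert f (T - {e}))"
      by (rule minimal_connecting_exchange[OF G T eT A(2) A(1) fG f(2)])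
    ultimately show ?thesis using f by blast
  qed
  then show ?thesis by (simp add: symmetric_exchange_def)
qed

section \<open>The spanning tree problem as an instance\<close>

theorem theorem19:
  fixes G :: "('v, 'e) ugraph" and c :: "'e \<Rightarrow> real" and E :: "'e set"
  assumes "finite_ugraph G" and "connected_ugraph G" and "E \<subseteq> edges G"
  shows "(\<Sum>e\<in>E. lower_tolerance (mstp G c) e) = set_lower_tolerance (mstp G c) E"
proof -
  have V: "verts G \<noteq> {}" using assms(2) by (simp add: connected_ugraph_def)
  have fin: "finite (edges G)" using assms(1) by (simp add: finite_ugraph_def)
  have sub: "spanning_trees G \<subseteq> Pow (edges G)" by (auto simp: spanning_trees_def)
  have "connecting G (edges G)"
    using connected_iff_connecting[OF assms(1) V, of "edges G"] assms(2) by simp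
  then have "spanning_trees G \<noteq> {}"
    using minimal_connecting_exists[OF fin] by (simp add: spanning_trees_eq[OF assms(1) V])
  moreover have "symmetric_exchange (spanning_trees G)"
    using symmetric_exchange_minimal_connecting[OF assms(1)]
    by (simp add: spanning_trees_eq[OF assms(1) V])
  moreover have "finite T" if "T \<in> spanning_trees G" for T
    using sub that fin by (auto intro: finite_subset)
  moreover have "finite (spanning_trees G)" using sub fin by (simp add: finite_subset)
  ultimately show ?thesis
    using assms(3) fin
    by (intro sum_lower_tolerance_eq_set_lower_tolerance) (auto simp: mstp_def intro: finite_subset)
qed

end
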